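(* Let $X$ be a symmetric real $m\times m$ matrix. The following conditions are equivalent: (i) $X$ is positive semidefinite; (ii) for every consecutive principal submatrix of $X$, at least one of its inner-saturated submatrices has a nonnegative determinant; (iii) for every consecutive principal submatrix of $X$, every one of its inner-saturated submatrices has a nonnegative determinant.
   Context: All matrices are real. A symmetric $m\times m$ matrix $X$ is positive semidefinite (PSD) if $c^{T}Xc\ge 0$ for every $c\in\mathbb{R}^m$. For integers $a\le b$, $a:b$ denotes $\{a,a+1,\dots,b\}$. For a matrix $X$ and index sets $I,J$, $X_{I,J}$ denotes the submatrix of $X$ with rows indexed by $I$ and columns indexed by $J$ (a single index $j$ stands for $\{j\}$). Consecutive principal submatrix: for an $m\times m$ matrix $X$ and integers $1\le a\le b\le m$, the matrix $X_{a:b,a:b}$ is called a consecutive principal submatrix of $X$. Inner-saturated submatrix: for a symmetric $n\times n$ matrix $Z$, a submatrix $Z_{I,I}$ is called an inner-saturated submatrix of $Z$ if $I=\{1,n\}\cup J$ where the index set $J$ satisfies: - if $n\le 2$, $J=\emptyset$; - if $n\ge 3$, $J\subseteq 2:(n-1)$ and $\{Z_{2:(n-1),j}: j\in J\}$ is a maximal linearly independent set of the column vectors of $Z_{2:(n-1),2:(n-1)}$ (that is, the columns indexed by $J$ are linearly independent as an indexed family, and $J$ is maximal with this property; if $Z_{2:(n-1),2:(n-1)}=0$, then $J=\emptyset$). A given $Z$ may have several inner-saturated submatrices. The inner-saturated submatrices of a consecutive principal submatrix $X_{a:b,a:b}$ are obtained by applying this definition to $Z=X_{a:b,a:b}$ (with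 rows and columns re-indexed by $1,\dots,b-a+1$). *)

theory Defs
  imports
    "Jordan_Normal_Form.DL_Submatrix"
    "Jordan_Normal_Form.VS_Connect"
    "Jordan_Normal_Form.Determinant"
begin

text \<open>Matrices are those of \<^theory>\<open>Jordan_Normal_Form.Matrix\<close>, so rows and columns are indexed from
  0: index \<open>i\<close> below is index \<open>i + 1\<close> in the usual numbering.\<close>

definition symmetric_mat :: "real mat \<Rightarrow> bool" where
  "symmetric_mat A \<longleftrightarrow> transpose_mat A = A"

definition positive_semidefinite :: "real mat \<Rightarrow> bool" where
  "positive_semidefinite A \<longleftrightarrow>
     symmetric_mat A \<and> (\<forall>c \<in> carrier_vec (dim_row A). c \<bullet> (A *\<^sub>v c) \<ge> 0)"

definition consecutive_principal :: "real mat \<Rightarrow> real mat \<Rightarrow> bool" where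
  "consecutive_principal X Z \<longleftrightarrow>
     (\<exists>a b. a \<le> b \<and> b < dim_row X \<and> Z = submatrix X {a..b} {a..b})"

text \<open>Independence as an indexed family: \<open>module.lin_dep\<close> speaks about sets of vectors, so
  injectivity is needed to exclude repeated columns.\<close>

definition cols_lin_indpt :: "real mat \<Rightarrow> nat set \<Rightarrow> bool" where
  "cols_lin_indpt A J \<longleftrightarrow>
     inj_on (col A) J \<and>
     \<not> module.lin_dep class_ring (module_vec TYPE(real) (dim_row A)) (col A ` J)"

text \<open>For an \<open>n \<times> n\<close> matrix \<open>Z\<close> the inner indices \<open>2:(n-1)\<close> are \<open>{1..<n - 1}\<close> here. In the last clause
  only the rows of \<open>Z\<close> are restricted, so that the inner columns keep their index in \<open>Z\<close>.\<close>

definition inner_saturated_index :: "real mat \<Rightarrow> nat set \<Rightarrow> bool" where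
  "inner_saturated_index Z I \<longleftrightarrow>
     (let n = dim_row Z in
      \<exists>J. I = {0, n - 1} \<union> J \<and>
          (if n \<le> 2 then J = {}
           else maximal J (\<lambda>K. K \<subseteq> {1..<n - 1} \<and>
                               cols_lin_indpt (submatrix Z {1..<n - 1} UNIV) K)))"

definition inner_saturated :: "real mat \<Rightarrow> real mat \<Rightarrow> bool" where
  "inner_saturated Z W \<longleftrightarrow> (\<exists>I. inner_saturated_index Z I \<and> W = submatrix Z I I)"

end

theory Submission
  imports Defs "Jordan_Normal_Form.DL_Rank"
begin

text \<open>A positive semidefinite matrix has positive semidefinite principal submatrices, whose
  determinants are nonnegative; this gives the determinant conditions. For the converse the
  blocks \<open>X\<^bsub>a:b,a:b\<^esub>\<close> are shown to be positive semidefinite by induction on their size. Let \<open>Z\<close> be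
  such a block, of size \<open>n \<ge> 2\<close>, and let \<open>M\<close> be its inner part, with the first and the last
  index removed. By induction \<open>Z\<close> is positive semidefinite on all indices but the last, and on
  all indices but the first. Let \<open>J\<close> index a maximal independent set of columns of \<open>M\<close> and let
  \<open>I = {0, n - 1} \<union> J\<close>, so that \<open>Z\<^bsub>I,I\<^esub>\<close> has a nonnegative determinant. Two facts finish the step.

  The form is nonnegative on \<open>I\<close> (lemma \<open>psd_on_if_det_nonneg\<close>). On \<open>J\<close> it is even positive
  definite: an isotropic vector of a semidefinite form is in its kernel, and a vector supported
  on \<open>J\<close> in the kernel of \<open>M\<close> is a relation between independent columns. Adding a small
  \<open>e > 0\<close> to the first diagonal entry of \<open>Z\<^bsub>I,I\<^esub>\<close> makes the form positive definite off the last
  index, and it does not decrease the determinant, since the complementary minor is nonnegative.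
  Once the minor that omits the last index is positive, a nonnegative determinant forces
  semidefiniteness: the last column of the adjugate is a vector that is orthogonal, for the form,
  to all vectors vanishing at the last index, and the form takes on it the value determinant
  times minor.

  The form on \<open>I\<close> determines the form on all indices (lemma \<open>psd_on_if_null_complement\<close>).
  By maximality each inner index \<open>k\<close> outside \<open>J\<close> carries a vector that is 1 at \<open>k\<close>, is otherwise
  supported on \<open>J\<close> and is in the kernel of \<open>M\<close>. It is isotropic, so it is in the kernel of both
  semidefinite overlapping blocks, hence in the kernel of \<open>Z\<close>, because every row of \<open>Z\<close> meets one
  of the two blocks. Subtracting multiples of these vectors turns any vector into one supported
  on \<open>I\<close> without changing the value of the form.\<close>

section \<open>Quadratic forms on index sets\<close>

text \<open>All of the argument but the determinants takes place on one matrix and varying sets of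
  indices, so vectors are functions on indices, of which only the values on \<open>S\<close> matter, and a
  submatrix is represented by its index set. Zero-padding relates different index sets.\<close>

definition col_comb :: "real mat \<Rightarrow> nat set \<Rightarrow> (nat \<Rightarrow> real) \<Rightarrow> nat \<Rightarrow> real" where
  "col_comb A S x i = (\<Sum>j\<in>S. A $$ (i, j) * x j)"

definition quad_form :: "real mat \<Rightarrow> nat set \<Rightarrow> (nat \<Rightarrow> real) \<Rightarrow> real" where
  "quad_form A S x = (\<Sum>i\<in>S. x i * col_comb A S x i)"

definition psd_on :: "real mat \<Rightarrow> nat set \<Rightarrow> bool" where
  "psd_on A S \<longleftrightarrow> (\<forall>x. quad_form A S x \<ge> 0)"

definition pd_on :: "real mat \<Rightarrow> nat set \<Rightarrow> bool" where
  "pd_on A S \<longleftrightarrow> (\<forall>x. (\<exists>i\<in>S. x i \<noteq> 0) \<longrightarrow> quad_form A S x > 0)"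

definition symmetric_on :: "real mat \<Rightarrow> nat set \<Rightarrow> bool" where
  "symmetric_on A S \<longleftrightarrow> (\<forall>i\<in>S. \<forall>j\<in>S. A $$ (i, j) = A $$ (j, i))"

lemma symmetric_on_subset: "symmetric_on A T \<Longrightarrow> S \<subseteq> T \<Longrightarrow> symmetric_on A S"
  by (auto simp: symmetric_on_def)

lemma col_comb_add: "col_comb A S (\<lambda>i. x i + t * y i) i = col_comb A S x i + t * col_comb A S y i"
  by (simp add: col_comb_def algebra_simps sum.distrib sum_distrib_left)

lemma col_comb_swap:
  assumes "symmetric_on A S"
  shows "(\<Sum>i\<in>S. x i * col_comb A S y i) = (\<Sum>i\<in>S. y i * col_comb A S x i)"
proof -
  have "(\<Sum>i\<in>S. x i * col_comb A S y i) = (\<Sum>i\<in>S. \<Sum>j\<in>S. A $$ (i, j) * x i * y j)"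
    by (simp add: col_comb_def sum_distrib_left mult_ac)
  also have "\<dots> = (\<Sum>j\<in>S. \<Sum>i\<in>S. A $$ (i, j) * x i * y j)"
    by (rule sum.swap)
  also have "\<dots> = (\<Sum>j\<in>S. \<Sum>i\<in>S. A $$ (j, i) * x i * y j)"
    using assms by (intro sum.cong refl) (auto simp: symmetric_on_def)
  also have "\<dots> = (\<Sum>i\<in>S. y i * col_comb A S x i)"
    by (simp add: col_comb_def sum_distrib_left mult_ac)
  finally show ?thesis .
qed

lemma quad_form_add:
  assumes "symmetric_on A S"
  shows "quad_form A S (\<lambda>i. x i + t * y i)
    = quad_form A S x + 2 * t * (\<Sum>i\<in>S. x i * col_comb A S y i) + t\<^sup>2 * quad_form A S y"
proof -
  have "quad_form A S (\<lambda>i. x i + t * y i)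
    = quad_form A S x + t * (\<Sum>i\<in>S. x i * col_comb A S y i) + t * (\<Sum>i\<in>S. y i * col_comb A S x i)
      + t\<^sup>2 * quad_form A S y"
    by (simp add: quad_form_def col_comb_add algebra_simps sum.distrib sum_distrib_left
        power2_eq_square)
  then show ?thesis
    using col_comb_swap[OF assms, of x y] by simp
qed

lemma quad_form_cong: "(\<And>i. i \<in> S \<Longrightarrow> x i = y i) \<Longrightarrow> quad_form A S x = quad_form A S y"
  by (simp add: quad_form_def col_comb_def cong: sum.cong)

lemma col_comb_restrict:
  assumes "finite T" "S \<subseteq> T" "\<And>i. i \<in> T - S \<Longrightarrow> x i = 0"
  shows "col_comb A T x i = col_comb A S x i"
  unfolding col_comb_def using assms by (intro sum.mono_neutral_right) auto

lemma quad_form_restrict: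
  assumes "finite T" "S \<subseteq> T" "\<And>i. i \<in> T - S \<Longrightarrow> x i = 0"
  shows "quad_form A T x = quad_form A S x"
proof -
  have "quad_form A T x = (\<Sum>i\<in>T. x i * col_comb A S x i)"
    using col_comb_restrict[OF assms] by (simp add: quad_form_def)
  also have "\<dots> = quad_form A S x"
    unfolding quad_form_def using assms by (intro sum.mono_neutral_right) auto
  finally show ?thesis .
qed

lemma psd_on_subset:
  assumes "psd_on A T" "finite T" "S \<subseteq> T"
  shows "psd_on A S"
  unfolding psd_on_def
proof
  fix x
  have "quad_form A S x = quad_form A S (\<lambda>i. if i \<in> S then x i else 0)"
    by (rule quad_form_cong) simp
  also have "\<dots> = quad_form A T (\<lambda>i. if i \<in> S then x i else 0)"
    by (rule quad_form_restrict[symmetric]) (use assms in auto)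
  finally show "quad_form A S x \<ge> 0"
    using assms(1) by (simp add: psd_on_def)
qed

lemma pd_on_imp_psd_on:
  assumes "pd_on A S"
  shows "psd_on A S"
  unfolding psd_on_def
proof
  fix x
  show "quad_form A S x \<ge> 0"
  proof (cases "\<exists>i\<in>S. x i \<noteq> 0")
    case True
    then show ?thesis using assms by (auto simp: pd_on_def intro: less_imp_le)
  next
    case False
    then show ?thesis by (simp add: quad_form_def)
  qed
qed

lemma quad_form_reindex:
  assumes "inj_on p S" "\<And>i j. i \<in> S \<Longrightarrow> j \<in> S \<Longrightarrow> B $$ (i, j) = A $$ (p i, p j)"
  shows "quad_form A (p ` S) x = quad_form B S (x \<circ> p)"
  using assms by (simp add: quad_form_def col_comb_def sum.reindex o_def cong: sum.cong)

text \<open>A submatrix arises from the matrix by an injective renumbering \<open>p\<close> of its indices. This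
  passes between blocks of a matrix and submatrices in their own numbering.\<close>
lemma psd_on_reindex:
  assumes "inj_on p S" "\<And>i j. i \<in> S \<Longrightarrow> j \<in> S \<Longrightarrow> B $$ (i, j) = A $$ (p i, p j)"
  shows "psd_on A (p ` S) \<longleftrightarrow> psd_on B S"
proof
  show "psd_on A (p ` S)" if "psd_on B S"
    using that quad_form_reindex[OF assms] by (simp add: psd_on_def)
  show "psd_on B S" if "psd_on A (p ` S)"
    unfolding psd_on_def
  proof
    fix x
    have "quad_form B S x = quad_form B S ((x \<circ> inv_into S p) \<circ> p)"
      by (rule quad_form_cong) (simp add: assms(1))
    also have "\<dots> = quad_form A (p ` S) (x \<circ> inv_into S p)"
      by (rule quad_form_reindex[OF assms, symmetric])
    finally show "quad_form B S x \<ge> 0"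
      using that by (simp add: psd_on_def)
  qed
qed

lemma pd_on_reindex:
  assumes "inj_on p S" "\<And>i j. i \<in> S \<Longrightarrow> j \<in> S \<Longrightarrow> B $$ (i, j) = A $$ (p i, p j)"
    and "pd_on A (p ` S)"
  shows "pd_on B S"
  unfolding pd_on_def
proof (intro allI impI)
  fix x :: "nat \<Rightarrow> real"
  assume "\<exists>i\<in>S. x i \<noteq> 0"
  then have "\<exists>i\<in>p ` S. (x \<circ> inv_into S p) i \<noteq> 0"
    by (auto simp: assms(1))
  then have "quad_form A (p ` S) (x \<circ> inv_into S p) > 0"
    using assms(3) by (simp only: pd_on_def)
  also have "quad_form A (p ` S) (x \<circ> inv_into S p) = quad_form B S ((x \<circ> inv_into S p) \<circ> p)"
    by (rule quad_form_reindex[OF assms(1,2)])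
  also have "\<dots> = quad_form B S x"
    by (rule quad_form_cong) (simp add: assms(1))
  finally show "quad_form B S x > 0" .
qed

text \<open>If the value at \<open>k\<close> were a nonzero \<open>b\<close>, the form at \<open>x\<close> plus a small multiple of the unit
  vector at \<open>k\<close>, of sign opposite to \<open>b\<close>, would be negative, because its linear term dominates.\<close>
lemma psd_on_isotropic_in_kernel:
  assumes "finite S" "symmetric_on A S" "psd_on A S" "quad_form A S x = 0" "k \<in> S"
  shows "col_comb A S x k = 0"
proof -
  define e :: "nat \<Rightarrow> real" where "e i = (if i = k then 1 else 0)" for i
  have [simp]: "(\<Sum>i\<in>S. e i * f i) = f k" for f :: "nat \<Rightarrow> real"
    using assms(1,5) by (simp add: e_def if_distrib[of "\<lambda>c. c * _"] cong: if_cong)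
  define b where "b = col_comb A S x k"
  define d where "d = quad_form A S e"
  have d: "d \<ge> 0" using assms(3) by (simp add: d_def psd_on_def)
  \<comment> \<open>Any small enough multiple works; dividing by \<open>d + 1\<close> rather than \<open>d\<close> covers \<open>d = 0\<close>.\<close>
  define t where "t = - b / (d + 1)"
  have "(\<Sum>i\<in>S. x i * col_comb A S e i) = b"
    using col_comb_swap[OF assms(2), of x e] by (simp add: b_def)
  then have "quad_form A S (\<lambda>i. x i + t * e i) = 2 * t * b + t\<^sup>2 * d"
    using quad_form_add[OF assms(2), of x t e] assms(4) by (simp add: d_def)
  moreover have "quad_form A S (\<lambda>i. x i + t * e i) \<ge> 0"
    using assms(3) by (simp add: psd_on_def)
  ultimately have "2 * t * b + t\<^sup>2 * d \<ge> 0" by simp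
  moreover have "b = - t * (d + 1)" using d by (simp add: t_def field_simps)
  ultimately have "t\<^sup>2 * (d + 2) \<le> 0" by (simp add: algebra_simps power2_eq_square)
  then have "t = 0" using d by (smt (verit) mult_pos_pos zero_less_power2)
  then show ?thesis using d by (simp add: t_def b_def)
qed

lemma col_comb_eq_mult_vec:
  assumes "A \<in> carrier_mat n n" "v \<in> carrier_vec n" "i < n"
  shows "(A *\<^sub>v v) $ i = col_comb A {..<n} (\<lambda>j. v $ j) i"
  using assms by (simp add: col_comb_def scalar_prod_def atLeast0LessThan)

lemma positive_semidefinite_iff_psd_on:
  assumes "A \<in> carrier_mat n n" "symmetric_mat A"
  shows "positive_semidefinite A \<longleftrightarrow> psd_on A {..<n}"
proof -
  have eq: "c \<bullet> (A *\<^sub>v c) = quad_form A {..<n} (\<lambda>i. c $ i)" if "c \<in> carrier_vec n" for c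
  proof -
    have "c \<bullet> (A *\<^sub>v c) = (\<Sum>i<n. c $ i * (A *\<^sub>v c) $ i)"
      using assms(1) by (simp add: scalar_prod_def atLeast0LessThan)
    then show ?thesis
      using col_comb_eq_mult_vec[OF assms(1) that] by (simp add: quad_form_def)
  qed
  have "quad_form A {..<n} x = quad_form A {..<n} (\<lambda>i. vec n x $ i)" for x
    by (rule quad_form_cong) simp
  then have "(\<forall>c\<in>carrier_vec n. quad_form A {..<n} (\<lambda>i. c $ i) \<ge> 0) \<longleftrightarrow> psd_on A {..<n}"
    unfolding psd_on_def by (metis vec_carrier)
  then show ?thesis
    using assms eq by (simp add: positive_semidefinite_def)
qed

section \<open>Determinants of semidefinite matrices\<close>

lemma det_eq_0_imp_quad_form_eq_0:
  assumes "A \<in> carrier_mat n n" "det A = 0"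
  obtains x i where "i < n" "x i \<noteq> 0" "quad_form A {..<n} x = 0"
proof -
  obtain v where v: "v \<in> carrier_vec n" "v \<noteq> 0\<^sub>v n" "A *\<^sub>v v = 0\<^sub>v n"
    using det_0_iff_vec_prod_zero_field[OF assms(1)] assms(2) by auto
  then obtain i where "i < n" "v $ i \<noteq> 0"
    by (metis carrier_vecD eq_vecI index_zero_vec(1) index_zero_vec(2))
  moreover have "quad_form A {..<n} (\<lambda>i. v $ i) = 0"
    using col_comb_eq_mult_vec[OF assms(1) v(1)] v(3) by (simp add: quad_form_def)
  ultimately show thesis by (rule that)
qed

text \<open>On the segment from the identity to \<open>A\<close> every matrix but possibly \<open>A\<close> itself is positive
  definite and therefore regular. The determinant starts at 1, so by the intermediate value
  theorem it cannot become negative.\<close>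
lemma det_nonneg_if_psd_on:
  assumes A: "A \<in> carrier_mat n n" and psd: "psd_on A {..<n}"
  shows "det A \<ge> 0"
proof (rule ccontr)
  assume neg: "\<not> det A \<ge> 0"
  define B where "B t = mat n n (\<lambda>(i, j). (1 - t) * (if i = j then 1 else 0) + t * A $$ (i, j))"
    for t :: real
  have B: "B t \<in> carrier_mat n n" for t by (simp add: B_def)
  have B_mult: "col_comb (B t) {..<n} x i = (1 - t) * x i + t * col_comb A {..<n} x i"
    if "i < n" for t x i
  proof -
    have "col_comb (B t) {..<n} x i
      = (\<Sum>j<n. (if j = i then (1 - t) * x i else 0) + t * (A $$ (i, j) * x j))"
      unfolding col_comb_def using that by (intro sum.cong) (auto simp: B_def algebra_simps)
    then show ?thesis
      using that by (simp add: sum.distrib col_comb_def sum_distrib_left)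
  qed
  have B_quad: "quad_form (B t) {..<n} x = (1 - t) * (\<Sum>i<n. (x i)\<^sup>2) + t * quad_form A {..<n} x"
    for t x
    by (simp add: quad_form_def B_mult algebra_simps sum.distrib sum_distrib_left power2_eq_square
        sum_subtractf)
  have "continuous_on {0..1} (\<lambda>t. det (B t))"
    unfolding det_def'[OF B]
  proof (intro continuous_intros)
    fix p i assume "p \<in> {p. p permutes {0..<n}}" "i \<in> {0..<n}"
    then have "i < n" "p i < n" using permutes_in_image by fastforce+
    then show "continuous_on {0..1} (\<lambda>t. B t $$ (i, p i))"
      by (cases "i = p i") (simp_all add: B_def continuous_intros)
  qed
  moreover have "det (B 0) = 1"
  proof -
    have "B 0 = 1\<^sub>m n" by (rule eq_matI) (auto simp: B_def)
    then show ?thesis by simp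
  qed
  moreover have "B 1 = A" by (rule eq_matI) (use A in \<open>auto simp: B_def\<close>)
  ultimately obtain t where t: "0 \<le> t" "t \<le> 1" "det (B t) = 0"
    using IVT2'[of "\<lambda>t. det (B t)" 1 0 0] neg by auto
  then have "t < 1" using \<open>B 1 = A\<close> neg by (cases "t = 1") auto
  obtain x i where x: "i < n" "x i \<noteq> 0" "quad_form (B t) {..<n} x = 0"
    using det_eq_0_imp_quad_form_eq_0[OF B t(3)] .
  have "(\<Sum>i<n. (x i)\<^sup>2) > 0"
    using x(1,2) by (intro sum_pos2[of _ i]) auto
  then have "(1 - t) * (\<Sum>i<n. (x i)\<^sup>2) > 0" using \<open>t < 1\<close> by simp
  moreover have "t * quad_form A {..<n} x \<ge> 0"
    using psd t(1) by (simp add: psd_on_def)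
  ultimately show False using x(3) by (simp add: B_quad)
qed

lemma det_pos_if_pd_on:
  assumes "A \<in> carrier_mat n n" "pd_on A {..<n}"
  shows "det A > 0"
proof -
  have "det A \<ge> 0" using assms by (intro det_nonneg_if_psd_on pd_on_imp_psd_on)
  moreover have "det A \<noteq> 0"
    using assms by (metis det_eq_0_imp_quad_form_eq_0 lessThan_iff less_irrefl pd_on_def)
  ultimately show ?thesis by simp
qed

text \<open>The minor at \<open>(q, q)\<close> belongs to the block without the index \<open>q\<close>, by the renumbering that
  skips \<open>q\<close>.\<close>
lemma insert_index_reindex:
  assumes "A \<in> carrier_mat n n" "q < n"
  shows "mat_delete A q q \<in> carrier_mat (n - 1) (n - 1)"
    and "inj_on (insert_index q) {..<n - 1}"
    and "insert_index q ` {..<n - 1} = {..<n} - {q}"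
    and "i < n - 1 \<Longrightarrow> j < n - 1 \<Longrightarrow>
      mat_delete A q q $$ (i, j) = A $$ (insert_index q i, insert_index q j)"
proof -
  show "mat_delete A q q \<in> carrier_mat (n - 1) (n - 1)"
    using assms(1) by (rule mat_delete_carrier)
  show "inj_on (insert_index q) {..<n - 1}"
    by (metis delete_insert_index inj_onI)
  show "insert_index q ` {..<n - 1} = {..<n} - {q}"
  proof
    show "insert_index q ` {..<n - 1} \<subseteq> {..<n} - {q}"
      by (auto simp: insert_index_def)
    show "{..<n} - {q} \<subseteq> insert_index q ` {..<n - 1}"
    proof
      fix i assume i: "i \<in> {..<n} - {q}"
      then have "i = insert_index q (delete_index q i)" by (simp add: insert_delete_index)
      moreover have "delete_index q i < n - 1"
        using i assms(2) by (auto simp: delete_index_def)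
      ultimately show "i \<in> insert_index q ` {..<n - 1}" by blast
    qed
  qed
  show "i < n - 1 \<Longrightarrow> j < n - 1 \<Longrightarrow>
      mat_delete A q q $$ (i, j) = A $$ (insert_index q i, insert_index q j)"
    using assms by (simp add: mat_delete_def insert_index_def)
qed

lemma minor_nonneg_if_psd_on:
  assumes "A \<in> carrier_mat n n" "q < n" "psd_on A ({..<n} - {q})"
  shows "det (mat_delete A q q) \<ge> 0"
proof (rule det_nonneg_if_psd_on)
  note r = insert_index_reindex[OF assms(1,2)]
  show "mat_delete A q q \<in> carrier_mat (n - 1) (n - 1)" by (rule r(1))
  show "psd_on (mat_delete A q q) {..<n - 1}"
    using psd_on_reindex[OF r(2), of "mat_delete A q q" A] r(3,4) assms(3) by simp
qed

lemma minor_pos_if_pd_on: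
  assumes "A \<in> carrier_mat n n" "q < n" "pd_on A ({..<n} - {q})"
  shows "det (mat_delete A q q) > 0"
proof (rule det_pos_if_pd_on)
  note r = insert_index_reindex[OF assms(1,2)]
  show "mat_delete A q q \<in> carrier_mat (n - 1) (n - 1)" by (rule r(1))
  show "pd_on (mat_delete A q q) {..<n - 1}"
    using pd_on_reindex[OF r(2), of "mat_delete A q q" A] r(3,4) assms(3) by simp
qed

text \<open>The column \<open>z\<close> of the adjugate with index \<open>q\<close> satisfies \<open>A z = det A \<cdot> e\<^sub>q\<close>, and its entry
  at \<open>q\<close> is the positive minor. Hence each \<open>x\<close> splits into a multiple of \<open>z\<close> and a vector \<open>y\<close> that
  vanishes at \<open>q\<close>, the two parts are orthogonal for the form, and the form is nonnegative on
  both. This is a Schur complement argument that solves no linear system.\<close>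
lemma psd_on_if_minor_pos:
  assumes A: "A \<in> carrier_mat n n" and sym: "symmetric_on A {..<n}" and q: "q < n"
    and psd: "psd_on A ({..<n} - {q})"
    and minor: "det (mat_delete A q q) > 0" and det: "det A \<ge> 0"
  shows "psd_on A {..<n}"
  unfolding psd_on_def
proof
  fix x
  define d where "d = det (mat_delete A q q)"
  define z where "z i = adj_mat A $$ (i, q)" for i
  have zq: "z q = d"
    using A q by (simp add: z_def d_def adj_mat_def cofactor_def)
  have Az: "col_comb A {..<n} z i = (if i = q then det A else 0)" if "i < n" for i
  proof -
    have "col_comb A {..<n} z i = (A * adj_mat A) $$ (i, q)"
      using A adj_mat(1)[OF A] q that
      by (simp add: col_comb_def z_def scalar_prod_def atLeast0LessThan)
    then show ?thesis
      using adj_mat(2)[OF A] q that by simp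
  qed
  have sum_Az: "(\<Sum>i<n. y i * col_comb A {..<n} z i) = y q * det A" for y
    using q by (simp add: Az if_distrib[of "\<lambda>c. _ * c"] cong: if_cong)
  define t where "t = x q / d"
  define y where "y i = x i - t * z i" for i
  have d: "d > 0" using minor by (simp add: d_def)
  then have yq: "y q = 0" by (simp add: y_def t_def zq)
  have "quad_form A {..<n} x = quad_form A {..<n} (\<lambda>i. y i + t * z i)"
    by (simp add: y_def)
  also have "\<dots> = quad_form A {..<n} y + t\<^sup>2 * (d * det A)"
    unfolding quad_form_add[OF sym] by (simp add: sum_Az yq zq quad_form_def[of A "{..<n}" z])
  also have "quad_form A {..<n} y = quad_form A ({..<n} - {q}) y"
    using yq by (intro quad_form_restrict) auto
  finally have "quad_form A {..<n} x = quad_form A ({..<n} - {q}) y + t\<^sup>2 * (d * det A)" .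
  moreover have "quad_form A ({..<n} - {q}) y \<ge> 0" using psd by (simp add: psd_on_def)
  ultimately show "quad_form A {..<n} x \<ge> 0" using d det by simp
qed

text \<open>Here the minor omitting \<open>q\<close> may vanish. Adding \<open>e > 0\<close> to the diagonal entry at \<open>p\<close> makes the
  form positive definite off \<open>q\<close>: only vectors that vanish at \<open>p\<close> do not gain from it, and on
  these the form is positive definite already. So that minor becomes positive, while the
  determinant grows by \<open>e\<close> times the minor omitting \<open>p\<close>, which is nonnegative. The previous lemma
  applies, and \<open>e\<close> tends to 0.\<close>
lemma psd_on_if_det_nonneg:
  assumes A: "A \<in> carrier_mat n n" and sym: "symmetric_on A {..<n}"
    and p: "p < n" and q: "q < n" and pq: "p \<noteq> q"
    and psd_p: "psd_on A ({..<n} - {p})" and psd_q: "psd_on A ({..<n} - {q})"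
    and pd: "pd_on A ({..<n} - {p, q})" and det: "det A \<ge> 0"
  shows "psd_on A {..<n}"
proof -
  define B where "B e = mat n n (\<lambda>(i, j). A $$ (i, j) + (if i = p \<and> j = p then e else 0))"
    for e :: real
  have B: "B e \<in> carrier_mat n n" for e by (simp add: B_def)
  have B_mult: "col_comb (B e) S x i = col_comb A S x i + (if i = p \<and> p \<in> S then e * x p else 0)"
    if "S \<subseteq> {..<n}" "i < n" for e S x i
  proof -
    have "finite S" using that finite_subset by blast
    have "col_comb (B e) S x i
      = (\<Sum>j\<in>S. A $$ (i, j) * x j + (if j = p then if i = p then e * x p else 0 else 0))"
      unfolding col_comb_def using that by (intro sum.cong) (auto simp: B_def algebra_simps)
    then show ?thesis
      using \<open>finite S\<close> by (simp add: sum.distrib col_comb_def)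
  qed
  have B_quad: "quad_form (B e) S x = quad_form A S x + (if p \<in> S then e * (x p)\<^sup>2 else 0)"
    if S: "S \<subseteq> {..<n}" for e S x
  proof -
    have "finite S" using that finite_subset by blast
    have "quad_form (B e) S x
      = (\<Sum>i\<in>S. x i * col_comb A S x i + (if i = p then if p \<in> S then e * (x p)\<^sup>2 else 0 else 0))"
      unfolding quad_form_def using B_mult[OF S] S
      by (intro sum.cong) (auto simp: algebra_simps power2_eq_square)
    then show ?thesis
      using \<open>finite S\<close> by (simp add: sum.distrib quad_form_def)
  qed
  have "psd_on (B e) {..<n}" if e: "e > 0" for e
  proof (rule psd_on_if_minor_pos[OF B _ q])
    show "symmetric_on (B e) {..<n}"
      using sym by (auto simp: symmetric_on_def B_def)
    have pd_q: "pd_on (B e) ({..<n} - {q})"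
      unfolding pd_on_def
    proof (intro allI impI)
      fix x assume x: "\<exists>i\<in>{..<n} - {q}. x i \<noteq> (0::real)"
      have *: "quad_form (B e) ({..<n} - {q}) x = quad_form A ({..<n} - {q}) x + e * (x p)\<^sup>2"
        using B_quad[of "{..<n} - {q}" e x] p pq by simp
      show "quad_form (B e) ({..<n} - {q}) x > 0"
      proof (cases "x p = 0")
        case False
        then have "e * (x p)\<^sup>2 > 0" using e by simp
        moreover have "quad_form A ({..<n} - {q}) x \<ge> 0" using psd_q by (simp add: psd_on_def)
        ultimately show ?thesis using * by linarith
      next
        case True
        have "quad_form A ({..<n} - {q}) x = quad_form A ({..<n} - {p, q}) x"
          using True by (intro quad_form_restrict) auto
        moreover have "\<exists>i\<in>{..<n} - {p, q}. x i \<noteq> 0" using x True by auto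
        then have "quad_form A ({..<n} - {p, q}) x > 0" using pd by (simp only: pd_on_def)
        ultimately show ?thesis using * True by simp
      qed
    qed
    then show "psd_on (B e) ({..<n} - {q})" by (rule pd_on_imp_psd_on)
    show "det (mat_delete (B e) q q) > 0" by (rule minor_pos_if_pd_on[OF B q pd_q])
    have cof: "cofactor (B e) i p = cofactor A i p" if "i < n" for i
    proof -
      have "mat_delete (B e) i p = mat_delete A i p"
        using A that p by (intro eq_matI) (auto simp: mat_delete_def B_def)
      then show ?thesis by (simp add: cofactor_def)
    qed
    have "det (B e) = (\<Sum>i<n. B e $$ (i, p) * cofactor A i p)"
      using laplace_expansion_column[OF B p] cof by simp
    also have "\<dots> = (\<Sum>i<n. A $$ (i, p) * cofactor A i p + (if i = p then e * cofactor A p p else 0))"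
      using p by (intro sum.cong) (auto simp: B_def algebra_simps)
    also have "\<dots> = det A + e * cofactor A p p"
      using laplace_expansion_column[OF A p] p by (simp add: sum.distrib)
    also have "cofactor A p p = det (mat_delete A p p)"
      by (simp add: cofactor_def)
    finally show "det (B e) \<ge> 0"
      using det e minor_nonneg_if_psd_on[OF A p psd_p] by simp
  qed
  then have B_nonneg: "quad_form (B e) {..<n} x \<ge> 0" if "e > 0" for e x
    using that unfolding psd_on_def by blast
  have *: "quad_form A {..<n} x + e * (x p)\<^sup>2 \<ge> 0" if "e > 0" for e x
    using B_quad[of "{..<n}" e x] B_nonneg[OF that, of x] p by simp
  show ?thesis
    unfolding psd_on_def
  proof
    fix x
    show "quad_form A {..<n} x \<ge> 0"
    proof (rule field_le_epsilon)
      fix e :: real assume "e > 0"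
      \<comment> \<open>The perturbation \<open>e / r\<close> adds \<open>(e / r) \<cdot> (x p)\<^sup>2 \<le> e\<close> to the form.\<close>
      define r where "r = (x p)\<^sup>2 + 1"
      have r: "r > 0" by (simp add: r_def add_nonneg_pos)
      have "e / r * (x p)\<^sup>2 \<le> e / r * r"
        using \<open>e > 0\<close> r by (intro mult_left_mono) (auto simp: r_def)
      also have "e / r * r = e" using r by simp
      finally show "0 \<le> quad_form A {..<n} x + e"
        using *[of "e / r" x] \<open>e > 0\<close> r by simp
    qed
  qed
qed

section \<open>Kernel vectors and the extension of semidefiniteness\<close>

text \<open>Padded by zeros, a kernel vector of a block of a semidefinite matrix is isotropic for the
  larger form, hence in the kernel of the larger matrix.\<close>
lemma null_extends:
  assumes "finite S" "T \<subseteq> S" "symmetric_on A S" "psd_on A S"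
    and "\<And>i. i \<in> S - T \<Longrightarrow> u i = 0" "\<And>i. i \<in> T \<Longrightarrow> col_comb A T u i = 0" "k \<in> S"
  shows "col_comb A S u k = 0"
proof (rule psd_on_isotropic_in_kernel[OF assms(1,3,4) _ assms(7)])
  have "quad_form A S u = quad_form A T u" by (rule quad_form_restrict) (use assms in auto)
  also have "\<dots> = 0" using assms(6) by (simp add: quad_form_def)
  finally show "quad_form A S u = 0" .
qed

text \<open>Subtracting kernel vectors does not change the form, and it clears the entries outside \<open>I\<close>
  one at a time: the vector for \<open>k\<close> does not affect the other entries outside \<open>I\<close>.\<close>
lemma psd_on_if_null_complement:
  assumes S: "finite S" and I: "I \<subseteq> S" and sym: "symmetric_on A S" and psd: "psd_on A I"
    and null: "\<And>k. k \<in> S - I \<Longrightarrow>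
      \<exists>u. u k = 1 \<and> (\<forall>i\<in>S - insert k I. u i = 0) \<and> (\<forall>i\<in>S. col_comb A S u i = 0)"
  shows "psd_on A S"
proof -
  have "psd_on A (I \<union> K)" if "finite K" "K \<subseteq> S - I" for K
    using that
  proof (induction K rule: finite_induct)
    case empty
    then show ?case using psd by simp
  next
    case (insert k K)
    let ?T = "I \<union> insert k K"
    have T: "?T \<subseteq> S" and fin: "finite ?T" using insert I S finite_subset by auto
    obtain u where u: "u k = 1" "\<forall>i\<in>S - insert k I. u i = 0" "\<forall>i\<in>S. col_comb A S u i = 0"
      using null[of k] insert.prems by auto
    have Au: "col_comb A ?T u i = 0" if "i \<in> ?T" for i
    proof -
      have "col_comb A S u i = col_comb A ?T u i" using u(2) S T by (intro col_comb_restrict) auto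
      then show ?thesis using u(3) that T by auto
    qed
    show ?case
      unfolding psd_on_def
    proof
      fix x
      define y where "y i = x i - x k * u i" for i
      have "quad_form A ?T x = quad_form A ?T (\<lambda>i. y i + x k * u i)" by (simp add: y_def)
      also have "\<dots> = quad_form A ?T y"
        unfolding quad_form_add[OF symmetric_on_subset[OF sym T]] using Au
        by (simp add: quad_form_def[of A _ u])
      also have "\<dots> = quad_form A (I \<union> K) y"
        using fin by (intro quad_form_restrict) (auto simp: y_def u(1))
      finally show "quad_form A ?T x \<ge> 0"
        using insert by (simp add: psd_on_def)
    qed
  qed
  from this[of "S - I"] show ?thesis using S I by (simp add: Un_absorb1)
qed

section \<open>Independent columns and inner-saturated index sets\<close>

text \<open>Linear relations with coefficients indexed by columns, which is the form in which kernel
  vectors supported on \<open>K\<close> appear. Repeated columns give the relation with coefficients 1 and -1,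
  so injectivity is implied.\<close>
lemma cols_lin_indpt_iff:
  assumes A: "A \<in> carrier_mat r c" and K: "K \<subseteq> {..<c}"
  shows "cols_lin_indpt A K \<longleftrightarrow>
    (\<forall>u. (\<forall>i<r. col_comb A K u i = 0) \<longrightarrow> (\<forall>j\<in>K. u j = 0))" (is "_ \<longleftrightarrow> ?R")
proof -
  interpret vec_space "TYPE(real)" r .
  have fin: "finite K" using K finite_subset by blast
  have cols: "col A ` K \<subseteq> carrier_vec r" using A by auto
  have entry: "col A j $ i = A $$ (i, j)" if "i < r" "j \<in> K" for i j
    using A K that by auto
  have lc: "lincomb a (col A ` K) $ i = col_comb A K (\<lambda>j. a (col A j)) i"
    if "inj_on (col A) K" "i < r" for a i
  proof -
    have "lincomb a (col A ` K) $ i = (\<Sum>v\<in>col A ` K. a v * v $ i)"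
      using that cols by (intro lincomb_index)
    also have "\<dots> = (\<Sum>j\<in>K. a (col A j) * col A j $ i)"
      using that by (simp add: sum.reindex)
    finally show ?thesis using entry that by (simp add: col_comb_def mult.commute)
  qed
  have dim_row: "dim_row A = r" using A by auto
  show ?thesis
  proof
    assume L: "cols_lin_indpt A K"
    then have inj: "inj_on (col A) K" and ind: "\<not> lin_dep (col A ` K)"
      by (auto simp: cols_lin_indpt_def dim_row)
    show ?R
    proof (intro allI impI ballI)
      fix u j assume u: "\<forall>i<r. col_comb A K u i = 0" and j: "j \<in> K"
      define a where "a v = u (inv_into K (col A) v)" for v
      have a: "a (col A j) = u j" if "j \<in> K" for j using inj that by (simp add: a_def)
      have "lincomb a (col A ` K) = 0\<^sub>v r"
      proof (rule eq_vecI)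
        fix i assume "i < dim_vec (0\<^sub>v r :: real vec)"
        then have i: "i < r" by simp
        have "lincomb a (col A ` K) $ i = col_comb A K (\<lambda>j. a (col A j)) i"
          by (rule lc[OF inj i])
        also have "\<dots> = col_comb A K u i" unfolding col_comb_def using a by simp
        finally show "lincomb a (col A ` K) $ i = 0\<^sub>v r $ i" using u i by simp
      qed (use fin cols lincomb_dim in auto)
      then have "a (col A j) = 0"
        using ind j fin unfolding lin_dep_def by (auto simp: class_ring_simps)
      then show "u j = 0" using a[OF j] by simp
    qed
  next
    assume R: ?R
    have inj: "inj_on (col A) K"
    proof (rule inj_onI, rule ccontr)
      fix j k assume jk: "j \<in> K" "k \<in> K" "col A j = col A k" "j \<noteq> k"
      define u :: "nat \<Rightarrow> real" where "u l = (if l = j then 1 else 0) - (if l = k then 1 else 0)" for l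
      have "col_comb A K u i = 0" if "i < r" for i
      proof -
        have "col_comb A K u i = A $$ (i, j) - A $$ (i, k)"
          using fin jk by (simp add: col_comb_def u_def right_diff_distrib sum_subtractf
              if_distrib[of "\<lambda>c. _ * c"] cong: if_cong)
        then show ?thesis
          using jk entry[OF that, of j] entry[OF that, of k] by simp
      qed
      then have "u j = 0" using R jk by blast
      then show False using jk by (simp add: u_def)
    qed
    have "\<not> lin_dep (col A ` K)"
    proof
      assume "lin_dep (col A ` K)"
      then obtain a v where a: "lincomb a (col A ` K) = 0\<^sub>v r" "v \<in> col A ` K" "a v \<noteq> 0"
        using finite_lin_dep[of "col A ` K"] fin cols by (auto simp: class_ring_simps)
      then have "\<forall>i<r. col_comb A K (\<lambda>j. a (col A j)) i = 0"
        using lc[OF inj] by (metis index_zero_vec(1))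
      then have "\<forall>j\<in>K. a (col A j) = 0" using R[rule_format, of "\<lambda>j. a (col A j)"] by blast
      then show False using a by auto
    qed
    then show "cols_lin_indpt A K" using inj by (simp add: cols_lin_indpt_def dim_row)
  qed
qed

lemma submatrix_reindex:
  assumes A: "A \<in> carrier_mat n n" and I: "I \<subseteq> {..<n}"
  shows "submatrix A I I \<in> carrier_mat (card I) (card I)"
    and "inj_on (pick I) {..<card I}"
    and "pick I ` {..<card I} = I"
    and "i < card I \<Longrightarrow> j < card I \<Longrightarrow> submatrix A I I $$ (i, j) = A $$ (pick I i, pick I j)"
proof -
  have fin: "finite I" using I finite_subset by blast
  have I_eq: "{i. i < dim_row A \<and> i \<in> I} = I" "{i. i < dim_col A \<and> i \<in> I} = I"
    using A I by auto
  show "submatrix A I I \<in> carrier_mat (card I) (card I)"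
    by (rule carrier_matI) (simp_all add: dim_submatrix I_eq)
  show inj: "inj_on (pick I) {..<card I}"
    by (rule inj_onI) (metis lessThan_iff linorder_neqE_nat order_less_irrefl pick_mono_le)
  show "pick I ` {..<card I} = I"
  proof (rule card_subset_eq[OF fin])
    show "pick I ` {..<card I} \<subseteq> I" by (auto intro: pick_in_set_le)
    show "card (pick I ` {..<card I}) = card I" by (simp add: card_image[OF inj])
  qed
  show "i < card I \<Longrightarrow> j < card I \<Longrightarrow> submatrix A I I $$ (i, j) = A $$ (pick I i, pick I j)"
    by (rule submatrix_index) (simp_all add: I_eq)
qed

lemma psd_on_submatrix_iff:
  assumes "A \<in> carrier_mat n n" "I \<subseteq> {..<n}"
  shows "psd_on (submatrix A I I) {..<card I} \<longleftrightarrow> psd_on A I"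
  using psd_on_reindex[OF submatrix_reindex(2)[OF assms], of "submatrix A I I" A]
    submatrix_reindex(3,4)[OF assms] by simp

lemma col_comb_inner_rows:
  assumes Z: "Z \<in> carrier_mat n n"
  shows "submatrix Z {1..<n - 1} UNIV \<in> carrier_mat (n - 2) n"
    and "K \<subseteq> {..<n} \<Longrightarrow> (\<forall>i<n - 2. col_comb (submatrix Z {1..<n - 1} UNIV) K u i = 0) \<longleftrightarrow>
      (\<forall>i\<in>{1..<n - 1}. col_comb Z K u i = 0)"
proof -
  let ?T = "{1..<n - 1}"
  have rows: "{i. i < dim_row Z \<and> i \<in> ?T} = ?T" and cols: "{j. j < dim_col Z \<and> j \<in> UNIV} = {..<n}"
    using Z by auto
  show "submatrix Z ?T UNIV \<in> carrier_mat (n - 2) n"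
    unfolding carrier_mat_def dim_submatrix mem_Collect_eq rows cols by simp
  assume K: "K \<subseteq> {..<n}"
  have T: "?T \<subseteq> {..<n}" by auto
  have card: "card ?T = n - 2" by simp
  have "col_comb (submatrix Z ?T UNIV) K u i = col_comb Z K u (pick ?T i)" if "i < n - 2" for i
    unfolding col_comb_def
  proof (rule sum.cong[OF refl])
    fix j assume "j \<in> K"
    then have "j < n" using K by auto
    then show "submatrix Z ?T UNIV $$ (i, j) * u j = Z $$ (pick ?T i, j) * u j"
      using that submatrix_index[of i Z ?T j UNIV] unfolding rows cols card
      by (simp add: pick_UNIV)
  qed
  moreover have "(\<forall>i\<in>?T. P i) \<longleftrightarrow> (\<forall>i<n - 2. P (pick ?T i))" for P
    using submatrix_reindex(3)[OF Z T] unfolding card by (metis image_iff lessThan_iff)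
  ultimately show "(\<forall>i<n - 2. col_comb (submatrix Z ?T UNIV) K u i = 0) \<longleftrightarrow>
      (\<forall>i\<in>?T. col_comb Z K u i = 0)"
    by simp
qed

text \<open>The properties of \<open>J\<close> in terms of the inner block: no nonzero kernel vector is supported on
  \<open>J\<close>, and by maximality every further inner index can be added to \<open>J\<close> to support one. Its entry at the
  new index is nonzero, by the independence on \<open>J\<close>, and is scaled to 1. For \<open>n = 2\<close> the inner
  block is empty.\<close>
lemma inner_saturated_indexE:
  assumes Z: "Z \<in> carrier_mat n n" and n: "n \<ge> 2" and I: "inner_saturated_index Z I"
  obtains J where "I = {0, n - 1} \<union> J" "J \<subseteq> {1..<n - 1}"
    and "\<forall>u. (\<forall>i\<in>{1..<n - 1}. col_comb Z J u i = 0) \<longrightarrow> (\<forall>j\<in>J. u j = 0)"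
    and "\<forall>k\<in>{1..<n - 1} - J. \<exists>u. u k = 1 \<and> (\<forall>i. i \<notin> insert k J \<longrightarrow> u i = 0) \<and>
      (\<forall>i\<in>{1..<n - 1}. col_comb Z {1..<n - 1} u i = 0)"
proof -
  let ?T = "{1..<n - 1}"
  let ?R = "submatrix Z ?T UNIV"
  have dim: "dim_row Z = n" using Z by auto
  obtain J where IJ: "I = {0, n - 1} \<union> J" and J: "if n \<le> 2 then J = {}
      else maximal J (\<lambda>K. K \<subseteq> ?T \<and> cols_lin_indpt ?R K)"
    using I unfolding inner_saturated_index_def Let_def dim by auto
  show thesis
  proof (cases "n \<le> 2")
    case True
    then show thesis using that[of J] IJ J by auto
  next
    case False
    then have JT: "J \<subseteq> ?T" and ind: "cols_lin_indpt ?R J"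
      and max: "\<And>K. J \<subseteq> K \<Longrightarrow> K \<subseteq> ?T \<Longrightarrow> cols_lin_indpt ?R K \<Longrightarrow> K = J"
      using J by (auto simp: maximal_def)
    have iff: "cols_lin_indpt ?R K \<longleftrightarrow>
      (\<forall>u. (\<forall>i\<in>?T. col_comb Z K u i = 0) \<longrightarrow> (\<forall>j\<in>K. u j = 0))" if "K \<subseteq> ?T" for K
    proof -
      have "?T \<subseteq> {..<n}" by auto
      then have K: "K \<subseteq> {..<n}" using that by (rule subset_trans[rotated])
      show ?thesis
        using cols_lin_indpt_iff[OF col_comb_inner_rows(1)[OF Z] K] col_comb_inner_rows(2)[OF Z K]
        by simp
    qed
    have indep: "\<forall>u. (\<forall>i\<in>?T. col_comb Z J u i = 0) \<longrightarrow> (\<forall>j\<in>J. u j = 0)"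
      using ind unfolding iff[OF JT] .
    show thesis
    proof (rule that[OF IJ JT indep], rule ballI)
      fix k assume k: "k \<in> ?T - J"
      let ?K = "insert k J"
      have KT: "?K \<subseteq> ?T" and fin: "finite ?T" "finite J" using k JT finite_subset by auto
      have "\<not> cols_lin_indpt ?R ?K" using max[of ?K] KT k by auto
      then obtain u where u: "\<forall>i\<in>?T. col_comb Z ?K u i = 0" "\<exists>j\<in>?K. u j \<noteq> 0"
        unfolding iff[OF KT] by blast
      have col_comb_insert: "col_comb Z ?K u i = Z $$ (i, k) * u k + col_comb Z J u i" for i
        unfolding col_comb_def using k fin by simp
      have uk: "u k \<noteq> 0"
      proof
        assume "u k = 0"
        then have "\<forall>j\<in>J. u j = 0" using indep[rule_format, of u] u(1) col_comb_insert by simp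
        then show False using u(2) \<open>u k = 0\<close> by auto
      qed
      define v where "v i = (if i \<in> ?K then u i / u k else 0)" for i
      have "col_comb Z ?T v i = 0" if "i \<in> ?T" for i
      proof -
        have "col_comb Z ?T v i = col_comb Z ?K v i"
          using KT fin by (intro col_comb_restrict) (auto simp: v_def)
        also have "\<dots> = col_comb Z ?K u i / u k"
          unfolding col_comb_def sum_divide_distrib by (rule sum.cong) (auto simp: v_def)
        finally show ?thesis using u(1) that by simp
      qed
      then show "\<exists>u. u k = 1 \<and> (\<forall>i. i \<notin> ?K \<longrightarrow> u i = 0) \<and> (\<forall>i\<in>?T. col_comb Z ?T u i = 0)"
        using uk by (intro exI[of _ v]) (auto simp: v_def)
    qed
  qed
qed

lemma inner_saturated_index_exists: "\<exists>I. inner_saturated_index Z I"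
proof -
  define n where "n = dim_row Z"
  let ?P = "\<lambda>K. K \<subseteq> {1..<n - 1} \<and> cols_lin_indpt (submatrix Z {1..<n - 1} UNIV) K"
  have "cols_lin_indpt R {}" for R
  proof -
    interpret vec_space "TYPE(real)" "dim_row R" .
    show ?thesis by (simp add: cols_lin_indpt_def lin_dep_def)
  qed
  then have "?P {}" by simp
  then obtain J where "maximal J ?P"
    using maximal_exists_superset[of "{1..<n - 1}" ?P "{}"] by auto
  then have "inner_saturated_index Z ({0, n - 1} \<union> (if n \<le> 2 then {} else J))"
    unfolding inner_saturated_index_def Let_def n_def[symmetric] by (cases "n \<le> 2") auto
  then show ?thesis ..
qed

lemma inner_saturated_index_subset:
  assumes "inner_saturated_index Z I" "Z \<in> carrier_mat n n" "n > 0"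
  shows "I \<subseteq> {..<n}"
proof (cases "n \<le> 2")
  case True
  then show ?thesis using assms by (auto simp: inner_saturated_index_def Let_def)
next
  case False
  then obtain J where "I = {0, n - 1} \<union> J" "J \<subseteq> {1..<n - 1}"
    using assms(1,2) by (auto simp: inner_saturated_index_def Let_def maximal_def)
  moreover have "{1..<n - 1} \<subseteq> {..<n}" by auto
  ultimately show ?thesis using False by auto
qed

section \<open>Induction over consecutive blocks\<close>

text \<open>The inductive step. The two hypotheses on blocks overlap in the inner indices, and together
  they cover all rows.\<close>
lemma psd_on_if_inner_saturated:
  assumes Z: "Z \<in> carrier_mat n n" and n: "n \<ge> 2" and sym: "symmetric_on Z {..<n}"
    and left: "psd_on Z ({..<n} - {n - 1})" and right: "psd_on Z ({..<n} - {0})"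
    and W: "inner_saturated Z W" and det: "det W \<ge> 0"
  shows "psd_on Z {..<n}"
proof -
  let ?T = "{1..<n - 1}"
  let ?L = "{..<n} - {n - 1}"
  let ?R = "{..<n} - {0}"
  obtain I where I: "inner_saturated_index Z I" and W_eq: "W = submatrix Z I I"
    using W by (auto simp: inner_saturated_def)
  obtain J where IJ: "I = {0, n - 1} \<union> J" and JT: "J \<subseteq> ?T"
    and indep: "\<forall>u. (\<forall>i\<in>?T. col_comb Z J u i = 0) \<longrightarrow> (\<forall>j\<in>J. u j = 0)"
    and span: "\<forall>k\<in>?T - J. \<exists>u. u k = 1 \<and> (\<forall>i. i \<notin> insert k J \<longrightarrow> u i = 0) \<and>
      (\<forall>i\<in>?T. col_comb Z ?T u i = 0)"
    using inner_saturated_indexE[OF Z n I] .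
  have sub: "I \<subseteq> {..<n}" using inner_saturated_index_subset[OF I Z] n by simp
  have TL: "?T \<subseteq> ?L" and TR: "?T \<subseteq> ?R" by auto
  have sym_sub: "symmetric_on Z S" if "S \<subseteq> {..<n}" for S using symmetric_on_subset[OF sym that] .
  have psd_T: "psd_on Z ?T" using psd_on_subset[OF left _ TL] by simp
  have pd_J: "pd_on Z J"
    unfolding pd_on_def
  proof (intro allI impI)
    fix x assume x: "\<exists>i\<in>J. x i \<noteq> (0::real)"
    \<comment> \<open>Padding with zeros makes the kernel of the whole inner block applicable.\<close>
    define y where "y i = (if i \<in> J then x i else 0)" for i
    have J_y: "quad_form Z J x = quad_form Z J y" by (rule quad_form_cong) (simp add: y_def)
    have T_y: "quad_form Z J y = quad_form Z ?T y"
      using JT by (intro quad_form_restrict[symmetric]) (auto simp: y_def)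
    have "quad_form Z ?T y \<noteq> 0"
    proof
      assume 0: "quad_form Z ?T y = 0"
      have "col_comb Z J y i = 0" if "i \<in> ?T" for i
      proof -
        have "col_comb Z ?T y i = 0"
          by (rule psd_on_isotropic_in_kernel[OF _ sym_sub psd_T 0 that]) auto
        moreover have "col_comb Z ?T y i = col_comb Z J y i"
          using JT by (intro col_comb_restrict) (auto simp: y_def)
        ultimately show ?thesis by simp
      qed
      then have "\<forall>j\<in>J. y j = 0" using indep by blast
      then show False using x by (simp add: y_def)
    qed
    then show "quad_form Z J x > 0"
      using psd_T J_y T_y by (simp add: psd_on_def order_less_le)
  qed
  have psd_I: "psd_on Z I"
  proof -
    let ?N = "card I"
    note r = submatrix_reindex[OF Z sub]
    have "0 \<in> pick I ` {..<?N}" "n - 1 \<in> pick I ` {..<?N}" unfolding r(3) using IJ by auto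
    then obtain p q where p: "p < ?N" "pick I p = 0" and q: "q < ?N" "pick I q = n - 1"
      by auto
    have pq: "p \<noteq> q" using p q n by auto
    have img: "pick I ` ({..<?N} - D) = I - pick I ` D" if "D \<subseteq> {..<?N}" for D
      using inj_on_image_set_diff[OF r(2) Diff_subset that] r(3) by simp
    have inj: "inj_on (pick I) ({..<?N} - D)" for D
      by (rule inj_on_diff[OF r(2)])
    have psd_iff: "psd_on W ({..<?N} - D) \<longleftrightarrow> psd_on Z (pick I ` ({..<?N} - D))" for D
      by (rule psd_on_reindex[OF inj, symmetric]) (simp add: W_eq r(4))
    have "psd_on W {..<?N}"
    proof (rule psd_on_if_det_nonneg[OF _ _ p(1) q(1) pq _ _ _ det])
      show "W \<in> carrier_mat ?N ?N" using r(1) W_eq by simp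
      show "symmetric_on W {..<?N}"
        unfolding symmetric_on_def
      proof (intro ballI)
        fix i j assume ij: "i \<in> {..<?N}" "j \<in> {..<?N}"
        then have "pick I i \<in> {..<n}" "pick I j \<in> {..<n}" using r(3) sub by blast+
        then have "Z $$ (pick I i, pick I j) = Z $$ (pick I j, pick I i)"
          using sym unfolding symmetric_on_def by blast
        then show "W $$ (i, j) = W $$ (j, i)" using r(4) ij W_eq by simp
      qed
      have "psd_on Z (I - {0})"
        by (rule psd_on_subset[OF right]) (use sub in auto)
      then show "psd_on W ({..<?N} - {p})"
        using psd_iff[of "{p}"] img[of "{p}"] p by simp
      have "psd_on Z (I - {n - 1})"
        by (rule psd_on_subset[OF left]) (use sub in auto)
      then show "psd_on W ({..<?N} - {q})"
        using psd_iff[of "{q}"] img[of "{q}"] q by simp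
      have "I - {0, n - 1} = J" using IJ JT by auto
      then show "pd_on W ({..<?N} - {p, q})"
        using pd_J img[of "{p, q}"] p q r(4) W_eq by (intro pd_on_reindex[OF inj]) simp_all
    qed
    then show ?thesis using psd_on_submatrix_iff[OF Z sub] W_eq by simp
  qed
  show ?thesis
  proof (rule psd_on_if_null_complement[OF _ sub sym psd_I])
    fix k assume k: "k \<in> {..<n} - I"
    then have "k \<in> ?T - J" using IJ by auto
    then obtain u where u: "u k = 1" "\<forall>i. i \<notin> insert k J \<longrightarrow> u i = 0"
      "\<forall>i\<in>?T. col_comb Z ?T u i = 0"
      using span by blast
    have u0: "u i = 0" if "i \<notin> ?T" for i using u(2) that JT \<open>k \<in> ?T - J\<close> by auto
    have "col_comb Z {..<n} u i = 0" if i: "i < n" for i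
    proof -
      have "\<exists>S\<in>{?L, ?R}. i \<in> S" using i n by auto
      then obtain S where S: "S \<in> {?L, ?R}" "i \<in> S" by blast
      then have "psd_on Z S" "?T \<subseteq> S" "S \<subseteq> {..<n}" using left right TL TR by auto
      then have "col_comb Z S u i = 0"
        using u0 u(3) S(2) finite_subset[of S "{..<n}"]
        by (intro null_extends[of S ?T]) (auto intro: sym_sub)
      moreover have "col_comb Z {..<n} u i = col_comb Z S u i"
      proof (rule col_comb_restrict[OF finite_lessThan \<open>S \<subseteq> {..<n}\<close>])
        fix i assume "i \<in> {..<n} - S"
        then have "i \<notin> ?T" using \<open>?T \<subseteq> S\<close> by blast
        then show "u i = 0" by (rule u0)
      qed
      ultimately show ?thesis by simp
    qed
    then show "\<exists>u. u k = 1 \<and> (\<forall>i\<in>{..<n} - insert k I. u i = 0) \<and>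
        (\<forall>i\<in>{..<n}. col_comb Z {..<n} u i = 0)"
      using u(1,2) IJ by (intro exI[of _ u]) auto
  qed simp
qed

lemma inner_saturated_det_nonneg:
  assumes X: "X \<in> carrier_mat n n" and psd: "psd_on X {..<n}"
    and Z: "consecutive_principal X Z" and W: "inner_saturated Z W"
  shows "det W \<ge> 0"
proof -
  obtain a b where ab: "a \<le> b" "b < n" and Z_eq: "Z = submatrix X {a..b} {a..b}"
    using Z X by (auto simp: consecutive_principal_def)
  have sub: "{a..b} \<subseteq> {..<n}" using ab by auto
  let ?N = "card {a..b}"
  have Zc: "Z \<in> carrier_mat ?N ?N" using submatrix_reindex(1)[OF X sub] Z_eq by simp
  have "psd_on X {a..b}" using psd_on_subset[OF psd _ sub] by simp
  then have psd_Z: "psd_on Z {..<?N}" using psd_on_submatrix_iff[OF X sub] Z_eq by simp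
  obtain I where I: "inner_saturated_index Z I" and W_eq: "W = submatrix Z I I"
    using W by (auto simp: inner_saturated_def)
  have subI: "I \<subseteq> {..<?N}" using inner_saturated_index_subset[OF I Zc] ab by simp
  have "psd_on Z I" using psd_on_subset[OF psd_Z _ subI] by simp
  then show ?thesis
    using det_nonneg_if_psd_on[OF submatrix_reindex(1)[OF Zc subI]]
      psd_on_submatrix_iff[OF Zc subI] W_eq by simp
qed

text \<open>For a single index the only inner-saturated submatrix is the diagonal entry itself. A longer
  interval loses its first or its last index to give the blocks of the induction hypothesis.\<close>
lemma psd_on_interval:
  assumes X: "X \<in> carrier_mat n n" and sym: "symmetric_on X {..<n}"
    and sat: "\<And>Z. consecutive_principal X Z \<Longrightarrow> \<exists>W. inner_saturated Z W \<and> det W \<ge> 0"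
  shows "a \<le> b \<Longrightarrow> b < n \<Longrightarrow> psd_on X {a..b}"
proof (induction "b - a" arbitrary: a b rule: less_induct)
  case less
  define Z where "Z = submatrix X {a..b} {a..b}"
  let ?N = "card {a..b}"
  have sub: "{a..b} \<subseteq> {..<n}" using less.prems by auto
  have Zc: "Z \<in> carrier_mat ?N ?N" using submatrix_reindex(1)[OF X sub] Z_def by simp
  have shift: "inj_on (\<lambda>i. i + a) S" for S by simp
  have img: "(\<lambda>i. i + a) ` {..<?N} = {a..b}"
    using less.prems image_add_atLeastLessThan'[of a 0 ?N]
    by (simp add: atLeast0LessThan atLeastLessThanSuc_atLeastAtMost)
  have pick: "pick {a..b} i = i + a" if "i < ?N" for i
  proof -
    have "{x \<in> {a..b}. x < i + a} = {a..<i + a}" using that by auto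
    then show ?thesis using pick_card_in_set[of "i + a" "{a..b}"] that by simp
  qed
  have entry: "Z $$ (i, j) = X $$ (i + a, j + a)" if "i < ?N" "j < ?N" for i j
    using submatrix_reindex(4)[OF X sub that] pick that Z_def by simp
  have transfer: "psd_on Z S" if "S \<subseteq> {..<?N}" "psd_on X ((\<lambda>i. i + a) ` S)" for S
  proof -
    have "Z $$ (i, j) = X $$ (i + a, j + a)" if "i \<in> S" "j \<in> S" for i j
      using entry subsetD[OF \<open>S \<subseteq> {..<?N}\<close>] that by simp
    from psd_on_reindex[OF shift this] show ?thesis using that(2) by simp
  qed
  have "consecutive_principal X Z"
    using less.prems X Z_def by (auto simp: consecutive_principal_def)
  then obtain W where W: "inner_saturated Z W" "det W \<ge> 0" using sat by blast
  have "psd_on Z {..<?N}"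
  proof (cases "a = b")
    case True
    then have N: "?N = 1" by simp
    have "inner_saturated_index Z I \<longleftrightarrow> I = {0}" for I
      using Zc N by (auto simp: inner_saturated_index_def Let_def)
    then have W_eq: "W = submatrix Z {0} {0}" using W(1) by (auto simp: inner_saturated_def)
    have Z1: "Z \<in> carrier_mat 1 1" using Zc N by simp
    have "W $$ (0, 0) = Z $$ (0, 0)" "W \<in> carrier_mat 1 1"
      using submatrix_reindex(1)[OF Z1, of "{0}"] submatrix_reindex(4)[OF Z1, of "{0}" 0 0]
      by (simp_all add: W_eq)
    then have "Z $$ (0, 0) \<ge> 0" using W(2) by (simp add: det_single)
    then show ?thesis
      unfolding N
      by (simp add: psd_on_def quad_form_def col_comb_def mult.left_commute[of "_ 0" "Z $$ _"])
  next
    case False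
    then have ab: "a < b" and N: "?N \<ge> 2" using less.prems by auto
    show ?thesis
    proof (rule psd_on_if_inner_saturated[OF Zc N _ _ _ W])
      show "symmetric_on Z {..<?N}"
        using sym less.prems entry by (auto simp: symmetric_on_def)
      have "(\<lambda>i. i + a) ` ({..<?N} - {?N - 1}) = {a..b - 1}"
        using inj_on_image_set_diff[OF shift[of UNIV], of "{..<?N}" "{?N - 1}"] img ab by auto
      moreover have "psd_on X {a..b - 1}" using ab less.prems by (intro less.hyps) auto
      ultimately show "psd_on Z ({..<?N} - {?N - 1})" by (intro transfer) auto
      have "(\<lambda>i. i + a) ` ({..<?N} - {0}) = {Suc a..b}"
        using inj_on_image_set_diff[OF shift[of UNIV], of "{..<?N}" "{0}"] img ab by auto
      moreover have "psd_on X {Suc a..b}" using ab less.prems by (intro less.hyps) auto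
      ultimately show "psd_on Z ({..<?N} - {0})" by (intro transfer) auto
    qed
  qed
  then show "psd_on X {a..b}" using psd_on_submatrix_iff[OF X sub] Z_def by simp
qed

theorem theorem2:
  fixes X :: "real mat" and m :: nat
  assumes "X \<in> carrier_mat m m" and "symmetric_mat X"
  shows "(positive_semidefinite X \<longleftrightarrow>
            (\<forall>Z. consecutive_principal X Z \<longrightarrow> (\<exists>W. inner_saturated Z W \<and> det W \<ge> 0))) \<and>
         (positive_semidefinite X \<longleftrightarrow>
            (\<forall>Z. consecutive_principal X Z \<longrightarrow> (\<forall>W. inner_saturated Z W \<longrightarrow> det W \<ge> 0)))"
    (is "(?psd \<longleftrightarrow> ?some) \<and> (?psd \<longleftrightarrow> ?every)")
proof -
  have psd_iff: "?psd \<longleftrightarrow> psd_on X {..<m}"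
    by (rule positive_semidefinite_iff_psd_on[OF assms])
  have "?psd \<Longrightarrow> ?every"
    using inner_saturated_det_nonneg[OF assms(1)] by (simp add: psd_iff)
  moreover have "?every \<Longrightarrow> ?some"
    using inner_saturated_index_exists unfolding inner_saturated_def by blast
  moreover have ?psd if ?some
  proof (cases "m = 0")
    case True
    then show ?thesis by (simp add: psd_iff psd_on_def quad_form_def)
  next
    case False
    have "symmetric_on X {..<m}"
      using assms unfolding symmetric_mat_def symmetric_on_def
      by (metis carrier_matD index_transpose_mat(1) lessThan_iff)
    then have "psd_on X {0..m - 1}"
      using psd_on_interval[OF assms(1), of 0 "m - 1"] that False by simp
    moreover have "{0..m - 1} = {..<m}" using False by auto
    ultimately show ?thesis by (simp add: psd_iff)
  qed
  ultimately show ?thesis by blast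
qed

end
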